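(* Let $k\in\mathbb{Z}_{\ge0}$ and $t=\sum_{i=0}^{k}t_i2^i$ with $t_i\in\{0,1\}$, $t_k=1$, and $t_i=0$ for $i>k$. Then $$num_b(t)=\sum_{i=0}^{k}t_{k-i}\,4^{\sum_{j=0}^{i}t_{k-j+1}}\,A\!\left(\sum_{j=0}^{k-i}t_j2^j\right),$$ where, for an integer $s\ge1$ with binary digits $s=\sum_{j=0}^{m}s_j2^j$, $s_m=1$ (that is, $2^m\le s<2^{m+1}$), $$A(s)=2(2^{m+1}-s+1)(2^{m+1}-s)+1-\frac{2}{3}(2^m+1)(2^m+2)\prod_{j=0}^{m-1}(1-s_j),$$ and terms of the sum with $t_{k-i}=0$ are $0$. Moreover, for every $k\in\mathbb{Z}_{\ge0}$, $$cum_b(2^k)=\frac{8\cdot5^k}{9}+\frac{2}{9}8^k-\frac{1}{9}2^k.$$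
   Context: A two-dimensional elementary cellular automaton is a map $T:\{0,1\}^{\mathbb{Z}^2}\to\{0,1\}^{\mathbb{Z}^2}$ such that $(Tx)_{i,j}$ is given by a fixed local rule $f:\{0,1\}^5\to\{0,1\}$ applied to the center $C=x_{i,j}$ and its four von Neumann neighbors $U=x_{i,j+1}$, $D=x_{i,j-1}$, $L=x_{i-1,j}$, $R=x_{i+1,j}$. It is symmetrical if $f$ is invariant under left-right and top-bottom reflections and under rotations by multiples of $90^\circ$ of the four neighbors. Call two neighbors opposite if they are $\{U,D\}$ or $\{L,R\}$, and adjacent otherwise. $T_b$ denotes any symmetrical two-dimensional elementary cellular automaton whose local rule satisfies the following. If $C=0$: output $0$ if no neighbor is $1$; output $1$ if exactly one neighbor is $1$; output $0$ if exactly two neighbors are $1$ and they are adjacent; output $1$ if all four neighbors are $1$; the output is arbitrary if exactly two opposite neighbors, or exactly three neighbors, are $1$. If $C=1$: output $1$ if no neighbor is $1$; output $1$ if exactly one neighbor is $1$; output $0$ if exactly two neighbors are $1$ and they are adjacent; output $1$ if exactly two neighbors are $1$ and they are opposite; output $1$ if all four neighbors are $1$; the output is arbitrary if exactly three neighbors are $1$. (The arbitrary values, chosen compatibly with the symmetry, do not affect the orbit considered.) The single site seed $x_o\in\{0,1\}^{\mathbb{Z}^2}$ has $(x_o)_{0,0}=1$ and all other entries $0$. Define $num_b(0)=cum_b(0)=0$ and, for $t\ge1$, $num_b(t)=\sum_{(i,j)\in\mathbb{Z}^2}(T_b^{t-1}x_o)_{i,j}$ and $cum_b(t)=\sum_{n=1}^{t}num_b(n)$.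 Empty products are $1$. *)

theory Defs
  imports Complex_Main "HOL-Library.Discrete_Functions" "HOL-Library.Groups_Big_Fun"
begin

(* The states 1 and 0 are True and False; a configuration is indexed by (i, j). *)
type_synonym config = "int \<times> int \<Rightarrow> bool"

(* The arguments of a local rule are, in this order, C, U, D, L, R. *)
type_synonym local_rule = "bool \<Rightarrow> bool \<Rightarrow> bool \<Rightarrow> bool \<Rightarrow> bool \<Rightarrow> bool"

definition eca :: "local_rule \<Rightarrow> config \<Rightarrow> config" where
  "eca f x = (\<lambda>(i, j). f (x (i, j)) (x (i, j + 1)) (x (i, j - 1)) (x (i - 1, j)) (x (i + 1, j)))"

(* The last three conjuncts are the rotations by 90, 180 and 270 degrees. *)
definition symmetrical :: "local_rule \<Rightarrow> bool" where
  "symmetrical f \<longleftrightarrow> (\<forall>c u d l r.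
      f c u d r l = f c u d l r \<and>
      f c d u l r = f c u d l r \<and>
      f c r l u d = f c u d l r \<and>
      f c d u r l = f c u d l r \<and>
      f c l r d u = f c u d l r)"

definition nbr_count :: "bool \<Rightarrow> bool \<Rightarrow> bool \<Rightarrow> bool \<Rightarrow> nat" where
  "nbr_count u d l r = of_bool u + of_bool d + of_bool l + of_bool r"

definition two_opposite :: "bool \<Rightarrow> bool \<Rightarrow> bool \<Rightarrow> bool \<Rightarrow> bool" where
  "two_opposite u d l r \<longleftrightarrow> nbr_count u d l r = 2 \<and> (u \<and> d \<or> l \<and> r)"

definition two_adjacent :: "bool \<Rightarrow> bool \<Rightarrow> bool \<Rightarrow> bool \<Rightarrow> bool" where
  "two_adjacent u d l r \<longleftrightarrow> nbr_count u d l r = 2 \<and> \<not> two_opposite u d l r"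

definition rule_b :: "local_rule \<Rightarrow> bool" where
  "rule_b f \<longleftrightarrow> (\<forall>u d l r.
      (nbr_count u d l r = 0 \<longrightarrow> f False u d l r = False) \<and>
      (nbr_count u d l r = 1 \<longrightarrow> f False u d l r = True) \<and>
      (two_adjacent u d l r \<longrightarrow> f False u d l r = False) \<and>
      (nbr_count u d l r = 4 \<longrightarrow> f False u d l r = True) \<and>
      (nbr_count u d l r = 0 \<longrightarrow> f True u d l r = True) \<and>
      (nbr_count u d l r = 1 \<longrightarrow> f True u d l r = True) \<and>
      (two_adjacent u d l r \<longrightarrow> f True u d l r = False) \<and>
      (two_opposite u d l r \<longrightarrow> f True u d l r = True) \<and>
      (nbr_count u d l r = 4 \<longrightarrow> f True u d l r = True))"

definition is_Tb :: "(config \<Rightarrow> config) \<Rightarrow> bool" where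
  "is_Tb T \<longleftrightarrow> (\<exists>f. T = eca f \<and> symmetrical f \<and> rule_b f)"

definition seed :: config where
  "seed = (\<lambda>p. p = (0, 0))"

(* Sum_any is the sum over the whole lattice; the support is finite by finite_orbit below. *)
definition num :: "(config \<Rightarrow> config) \<Rightarrow> nat \<Rightarrow> nat" where
  "num T t = (if t = 0 then 0 else Sum_any (\<lambda>p. of_bool ((T ^^ (t - 1)) seed p)))"

definition cum :: "(config \<Rightarrow> config) \<Rightarrow> nat \<Rightarrow> nat" where
  "cum T t = (\<Sum>n=1..t. num T n)"

(* Here m = floor_log s satisfies 2 ^ m \<le> s < 2 ^ (m + 1) for s \<ge> 1, and bit s j is the
   binary digit of s at position j. *)
definition A :: "nat \<Rightarrow> real" where
  "A s = (let m = floor_log s in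
      2 * (2 ^ (m + 1) - real s + 1) * (2 ^ (m + 1) - real s) + 1
      - 2 / 3 * (2 ^ m + 1) * (2 ^ m + 2) * (\<Prod>j<m. 1 - of_bool (bit s j)))"

lemma finite_support_eca:
  assumes "is_Tb T" and fin: "finite {p. x p}"
  shows "finite {p. T x p}"
proof -
  obtain f where f: "T = eca f" "rule_b f"
    using assms(1) by (auto simp: is_Tb_def)
  then have f0: "\<not> f False False False False False"
    unfolding rule_b_def nbr_count_def by (metis add.right_neutral of_bool_eq(1))
  let ?S = "{p. x p}"
  have "{p. T x p} \<subseteq> ?S \<union> (\<lambda>(i, j). (i, j - 1)) ` ?S \<union> (\<lambda>(i, j). (i, j + 1)) ` ?S
      \<union> (\<lambda>(i, j). (i + 1, j)) ` ?S \<union> (\<lambda>(i, j). (i - 1, j)) ` ?S"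
  proof
    fix p assume p: "p \<in> {p. T x p}"
    obtain i j where ij: "p = (i, j)" by fastforce
    have "x (i, j) \<or> x (i, j + 1) \<or> x (i, j - 1) \<or> x (i - 1, j) \<or> x (i + 1, j)"
    proof (rule ccontr)
      assume "\<not> ?thesis"
      then have "T x p = f False False False False False"
        by (simp add: f eca_def ij)
      then show False using p f0 by simp
    qed
    then show "p \<in> ?S \<union> (\<lambda>(i, j). (i, j - 1)) ` ?S \<union> (\<lambda>(i, j). (i, j + 1)) ` ?S
      \<union> (\<lambda>(i, j). (i + 1, j)) ` ?S \<union> (\<lambda>(i, j). (i - 1, j)) ` ?S"
      unfolding ij by (force simp: image_iff)
  qed
  then show ?thesis
    by (rule finite_subset) (use fin in auto)
qed

lemma finite_orbit:
  assumes "is_Tb T"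
  shows "finite {p. (T ^^ n) seed p}"
proof (induction n)
  case 0
  then show ?case by (simp add: seed_def)
next
  case (Suc n)
  then show ?case using finite_support_eca[OF assms] by simp
qed

end

theory Submission
  imports Defs
begin

text \<open>
  For \<open>r < 2 ^ k\<close>, generation \<open>2 ^ k + r\<close> of the orbit is the ball of radius \<open>2 ^ k - 1 - r\<close> around
  the origin in the taxicab metric, together with four disjoint copies of generation \<open>r\<close> centred
  at distance \<open>2 ^ k\<close> on the axes. While \<open>r + 1 < 2 ^ k\<close>, the ball and the copies touch only at
  their tips on the axes, and there each evolves as it would alone, except that the tip given up by
  the shrinking ball is taken over by the growing copy. When \<open>r + 1 = 2 ^ k\<close>, all
  sites of odd coordinate sum within distance \<open>2 ^ (k + 1) - 1\<close> are alive and all sites with two odd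
  coordinates are dead, which determines the next generation whatever the even-even sites are: a
  ball with four tips. Counting live sites gives, for \<open>1 \<le> s \<le> 2 ^ k\<close> and \<open>R = 2 ^ k - s\<close>,
  \<open>num (2 ^ k + s) = 4 num s + 2 R (R + 1) + 1\<close>, and both formulas follow by induction.
\<close>

section \<open>The local rule, symmetries and light cone of the orbit\<close>

locale b_rule =
  fixes f :: local_rule
  assumes symmetrical: "symmetrical f" and rule_b: "rule_b f"
begin

definition orbit :: "nat \<Rightarrow> config" where
  "orbit n = (eca f ^^ n) seed"

lemma orbit_0 [simp]: "orbit 0 (i, j) \<longleftrightarrow> i = 0 \<and> j = 0"
  by (simp add: orbit_def seed_def)

lemma orbit_Suc:
  "orbit (Suc n) (i, j) = f (orbit n (i, j)) (orbit n (i, j + 1)) (orbit n (i, j - 1))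
     (orbit n (i - 1, j)) (orbit n (i + 1, j))"
  by (simp add: orbit_def eca_def)

lemmas rule_at = rule_b[unfolded rule_b_def, THEN spec[where x = u], THEN spec[where x = d],
    THEN spec[where x = l], THEN spec[where x = r]] for u d l r

lemma rule_none: "f False False False False False = False"
  using rule_at[of False False False False] by (simp add: nbr_count_def)

lemma rule_single:
  "f False True False False False" "f False False True False False"
  "f False False False True False" "f False False False False True"
  using rule_at[of True False False False] rule_at[of False True False False]
    rule_at[of False False True False] rule_at[of False False False True]
  by (simp_all add: nbr_count_def)

lemma rule_all: "f c True True True True"
  using rule_at[of True True True True] by (cases c) (simp_all add: nbr_count_def)

text \<open>Merges the clauses for zero, one and two opposite live neighbours: a live centre
  survives once one axis is dead, whatever the other axis holds.\<close>

lemma rule_opposite: "f True u d False False" "f True False False l r"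
  using rule_at[of u d False False] rule_at[of False False l r]
  by (cases u; cases d; cases l; cases r; simp add: nbr_count_def two_opposite_def)+

lemma rule_adjacent: "f c u (\<not> u) l (\<not> l) = False"
  using rule_at[of u "\<not> u" l "\<not> l"]
  by (cases c; cases u; cases l)
    (simp_all add: nbr_count_def two_adjacent_def two_opposite_def)

lemma orbit_reflect: "orbit n (- i, j) = orbit n (i, j)"
proof (induction n arbitrary: i j)
  case (Suc n)
  have "- i - 1 = - (i + 1)" "- i + 1 = - (i - 1)"
    by simp_all
  then have "orbit n (- i - 1, j) = orbit n (i + 1, j)"
    "orbit n (- i + 1, j) = orbit n (i - 1, j)"
    by (simp_all only: Suc)
  then show ?case
    using symmetrical by (simp add: orbit_Suc Suc symmetrical_def)
qed simp

lemma orbit_swap: "orbit n (j, i) = orbit n (i, j)"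
proof (induction n arbitrary: i j)
  case (Suc n)
  \<comment> \<open>Reflection in the diagonal, obtained as a quarter turn composed with an axis
    reflection.\<close>
  have "f c r l d u = f c u d l r" for c u d l r
    using symmetrical unfolding symmetrical_def by metis
  then show ?case
    by (simp add: orbit_Suc Suc[of j i] Suc[of "j + 1" i] Suc[of "j - 1" i]
        Suc[of j "i - 1"] Suc[of j "i + 1"])
qed auto

text \<open>A dead site with four dead neighbours stays dead, so the live region spreads by at most
  one taxicab unit per step.\<close>

lemma orbit_support: "orbit n (i, j) \<Longrightarrow> \<bar>i\<bar> + \<bar>j\<bar> \<le> int n"
proof (induction n arbitrary: i j)
  case (Suc n)
  show ?case
  proof (rule ccontr)
    assume far: "\<not> ?thesis"
    have "\<not> orbit n (i, j)" "\<not> orbit n (i, j + 1)" "\<not> orbit n (i, j - 1)"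
      "\<not> orbit n (i - 1, j)" "\<not> orbit n (i + 1, j)"
      using far by (auto dest!: Suc.IH)
    then show False
      using Suc.prems by (simp add: orbit_Suc rule_none)
  qed
qed simp

lemma orbit_outside: "\<bar>i\<bar> + \<bar>j\<bar> > int n \<Longrightarrow> orbit n (i, j) = False"
  by (auto dest: orbit_support)

text \<open>Next to the new extreme site only the old tip is alive. The left tip is the one that, in
  the copy centred at \<open>(M, 0)\<close>, points at the ball.\<close>

lemma orbit_tip: "orbit n (- int n, 0)"
proof (induction n)
  case (Suc n)
  then show ?case
    by (simp add: orbit_Suc orbit_outside rule_single)
qed simp

lemma orbit_below_tip: "orbit (Suc n) (- int n, 0)"
  using orbit_tip[of n] by (simp add: orbit_Suc orbit_outside rule_opposite)

section \<open>Evolution within a stage\<close>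

definition stage :: "nat \<Rightarrow> nat \<Rightarrow> int \<Rightarrow> int \<Rightarrow> bool" where
  "stage M r x y \<longleftrightarrow> \<bar>x\<bar> + \<bar>y\<bar> \<le> int M - 1 - int r
     \<or> orbit r (x - int M, y) \<or> orbit r (x + int M, y) \<or> orbit r (x, y - int M) \<or> orbit r (x, y + int M)"

lemma stage_reflect: "stage M r (- x) y = stage M r x y"
proof -
  have "orbit r (- x - int M, y) = orbit r (x + int M, y)"
    "orbit r (- x + int M, y) = orbit r (x - int M, y)"
    using orbit_reflect[of r "x + int M"] orbit_reflect[of r "x - int M"] by (simp_all add: algebra_simps)
  then show ?thesis
    by (auto simp: stage_def orbit_reflect)
qed

lemma stage_swap: "stage M r y x = stage M r x y"
  unfolding stage_def using orbit_swap[of r] by (simp add: add.commute) blast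

text \<open>Both sides are invariant under reflection and swap, hence under all symmetries of the
  square, for which this octant is a fundamental domain.\<close>

lemma octant_eqI:
  assumes "\<And>x y. 0 \<le> y \<Longrightarrow> y \<le> x \<Longrightarrow> orbit n (x, y) = stage M r x y"
  shows "orbit n (x, y) = stage M r x y"
proof -
  have abs: "orbit n (\<bar>x\<bar>, \<bar>y\<bar>) = orbit n (x, y)" "stage M r \<bar>x\<bar> \<bar>y\<bar> = stage M r x y" for x y
    using orbit_reflect[of n] orbit_swap[of n] stage_reflect[of M r] stage_swap[of M r]
    by (metis abs_if)+
  show ?thesis
    using assms[of "\<bar>y\<bar>" "\<bar>x\<bar>"] assms[of "\<bar>x\<bar>" "\<bar>y\<bar>"] abs[of x y] orbit_swap[of n "\<bar>x\<bar>" "\<bar>y\<bar>"]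
      stage_swap[of M r "\<bar>x\<bar>" "\<bar>y\<bar>"]
    by linarith
qed

text \<open>The bounds on \<open>x\<close> and \<open>y\<close> hold on the octant and at all
  neighbours of its sites. There the other three centres are at distance at least
  \<open>M - 1\<close>, which exceeds \<open>r\<close>.\<close>

lemma stage_right:
  assumes "r + 1 < M" "- 1 \<le> x" "y \<le> x + 1" "-1 \<le> y" "-1 \<le> x + y"
  shows "stage M r x y \<longleftrightarrow> \<bar>x\<bar> + \<bar>y\<bar> \<le> int M - 1 - int r \<or> orbit r (x - int M, y)"
proof -
  have "\<not> orbit r (x + int M, y)" "\<not> orbit r (x, y - int M)" "\<not> orbit r (x, y + int M)"
    using assms by (auto simp: orbit_outside)
  then show ?thesis
    by (simp add: stage_def)
qed

text \<open>Interior sites have four live neighbours. At distance \<open>R\<close> or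
  \<open>R + 1\<close>, off-axis sites have exactly the two inward neighbours alive and end up dead,
  while on the axis the vertical neighbours are dead and the live centre survives. Farther out only
  the copy matters.\<close>

lemma orbit_stage_Suc:
  assumes r: "r + 1 < M" and IH: "\<And>x y. orbit (M + r) (x, y) = stage M r x y"
  shows "orbit (M + Suc r) (x, y) = stage M (Suc r) x y"
proof (rule octant_eqI)
  fix x y :: int assume xy: "0 \<le> y" "y \<le> x"
  define R where "R = int M - 1 - int r"
  have near: "orbit (M + r) (a, b) \<longleftrightarrow> \<bar>a\<bar> + \<bar>b\<bar> \<le> R \<or> orbit r (a - int M, b)"
    if "\<bar>a - x\<bar> + \<bar>b - y\<bar> \<le> 1" for a b
    unfolding IH R_def by (rule stage_right) (use that r xy in linarith)+
  have goal: "stage M (Suc r) x y \<longleftrightarrow> x + y \<le> R - 1 \<or> orbit (Suc r) (x - int M, y)"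
  proof -
    have "\<not> orbit (Suc r) (x + int M, y)" "\<not> orbit (Suc r) (x, y - int M)"
      "\<not> orbit (Suc r) (x, y + int M)"
      using xy r by (auto simp: orbit_outside)
    then show ?thesis
      using xy by (auto simp: stage_def R_def)
  qed
  have step: "orbit (Suc (M + r)) (x, y) = f (orbit (M + r) (x, y)) (orbit (M + r) (x, y + 1))
      (orbit (M + r) (x, y - 1)) (orbit (M + r) (x - 1, y)) (orbit (M + r) (x + 1, y))"
    by (simp add: orbit_Suc)
  consider "x + y \<le> R - 1" | "x + y = R" "y > 0" | "x + y = R" "y = 0"
    | "x + y = R + 1" "y > 0" | "x + y = R + 1" "y = 0" | "x + y \<ge> R + 2"
    using xy by linarith
  then show "orbit (M + Suc r) (x, y) = stage M (Suc r) x y"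
  proof cases
    case 1
    then have "orbit (M + r) (x, y + 1)" "orbit (M + r) (x, y - 1)"
      "orbit (M + r) (x - 1, y)" "orbit (M + r) (x + 1, y)"
      using xy by (auto simp: near)
    then show ?thesis
      using 1 by (simp add: goal step rule_all)
  next
    case 2
    have "orbit (M + r) (x, y - 1)" "orbit (M + r) (x - 1, y)"
      "\<not> orbit (M + r) (x, y + 1)" "\<not> orbit (M + r) (x + 1, y)"
      using 2 xy R_def by (simp_all add: near orbit_outside)
    moreover have "\<not> stage M (Suc r) x y"
      using 2 xy R_def by (simp add: goal orbit_outside)
    ultimately show ?thesis
      using rule_adjacent[of _ False True] by (simp add: step)
  next
    \<comment> \<open>The tip given up by the ball: seen from \<open>(M, 0)\<close> it is
      \<open>(- Suc r, 0)\<close>, the tip of the copy one step later.\<close>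
    case 3
    have "orbit (M + r) (x, y)" "\<not> orbit (M + r) (x, y - 1)" "\<not> orbit (M + r) (x, y + 1)"
      using 3 xy R_def by (simp_all add: near orbit_outside)
    moreover have "x - int M = - int (Suc r)" using 3 R_def by simp
    ultimately show ?thesis
      unfolding add_Suc_right step goal using orbit_tip[of "Suc r"] 3 by (simp add: rule_opposite)
  next
    case 4
    have "orbit (M + r) (x, y - 1)" "orbit (M + r) (x - 1, y)"
      "\<not> orbit (M + r) (x, y + 1)" "\<not> orbit (M + r) (x + 1, y)"
      using 4 xy R_def by (simp_all add: near orbit_outside)
    moreover have "\<not> stage M (Suc r) x y"
      using 4 xy R_def by (simp add: goal orbit_outside)
    ultimately show ?thesis
      using rule_adjacent[of _ False True] by (simp add: step)
  next
    case 5
    have c: "x - int M = - int r" using 5 R_def by simp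
    have "orbit (M + r) (x, y)" "\<not> orbit (M + r) (x, y - 1)" "\<not> orbit (M + r) (x, y + 1)"
      using 5 xy c R_def orbit_tip[of r] by (simp_all add: near orbit_outside)
    then show ?thesis
      unfolding add_Suc_right step goal using orbit_below_tip[of r] 5 c by (simp add: rule_opposite)
  next
    case 6
    then have "\<not> x + \<bar>y - 1\<bar> \<le> R" "\<not> y + \<bar>x - 1\<bar> \<le> R"
      by linarith+
    then have "orbit (M + Suc r) (x, y) = orbit (Suc r) (x - int M, y)"
      using 6 xy by (simp add: step near orbit_Suc algebra_simps)
    then show ?thesis
      using 6 by (simp add: goal)
  qed
qed

section \<open>The checkerboard that starts a new stage\<close>

definition checkered :: "nat \<Rightarrow> bool" where
  "checkered N \<longleftrightarrow> (\<forall>x y. \<bar>x\<bar> + \<bar>y\<bar> < int N \<longrightarrow>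
     (odd (x + y) \<longrightarrow> orbit (N - 1) (x, y)) \<and> (odd x \<and> odd y \<longrightarrow> \<not> orbit (N - 1) (x, y)))"

text \<open>Computed directly from the seed, since the checkerboard argument requires an even
  \<open>N\<close>.\<close>

lemma orbit_stage_1_0: "orbit 1 (x, y) = stage 1 0 x y"
proof (rule octant_eqI)
  fix x y :: int assume xy: "0 \<le> y" "y \<le> x"
  consider "x = 0" "y = 0" | "x = 1" "y = 0" | "x = 1" "y = 1" | "x + y > 1" "x > 1"
    using xy by linarith
  then show "orbit 1 (x, y) = stage 1 0 x y"
    using xy rule_opposite(1)[of False False] rule_single rule_adjacent[of False False True] rule_none
    by cases (auto simp: stage_def orbit_Suc[of 0, simplified])
qed

text \<open>Inside, even-sum sites see four live odd-sum neighbours, and live odd-sum sites have one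
  axis of dead odd-odd neighbours. At distance \<open>N\<close>, whose evenness makes the inward
  neighbours odd-sum, off-axis sites see an adjacent live pair and tips a single live site.\<close>

lemma orbit_stage_0:
  assumes N: "even N" "N > 0" and "checkered N"
  shows "orbit N (x, y) = stage N 0 x y"
proof (rule octant_eqI)
  fix x y :: int assume xy: "0 \<le> y" "y \<le> x"
  define Y where "Y = orbit (N - 1)"
  have step: "orbit N (x, y) = f (Y (x, y)) (Y (x, y + 1)) (Y (x, y - 1)) (Y (x - 1, y)) (Y (x + 1, y))"
    using orbit_Suc[of "N - 1"] N by (simp add: Y_def)
  have on: "Y (a, b)" if "\<bar>a\<bar> + \<bar>b\<bar> < int N" "odd (a + b)" for a b
    using assms(3) that by (auto simp: checkered_def Y_def)
  have off: "\<not> Y (a, b)" if "odd a" "odd b" for a b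
    using assms(3) that orbit_outside[of "N - 1" a b] N
    by (cases "\<bar>a\<bar> + \<bar>b\<bar> < int N") (auto simp: checkered_def Y_def)
  have out: "\<not> Y (a, b)" if "\<bar>a\<bar> + \<bar>b\<bar> \<ge> int N" for a b
    using orbit_outside[of "N - 1" a b] that N by (simp add: Y_def)
  have goal: "stage N 0 x y \<longleftrightarrow> x + y < int N \<or> x = int N \<and> y = 0"
    using xy N unfolding stage_def by auto
  consider "x + y < int N" "even (x + y)" | "x + y < int N" "odd x" "even y"
    | "x + y < int N" "even x" "odd y" | "x + y = int N" "y > 0" | "x + y = int N" "y = 0"
    | "x + y > int N"
    using xy by force
  then show "orbit N (x, y) = stage N 0 x y"
  proof cases
    case 1
    then have "x + y + 1 < int N"
      using N by presburger
    then have "Y (x, y + 1)" "Y (x, y - 1)" "Y (x - 1, y)" "Y (x + 1, y)"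
      using 1 xy by (auto intro!: on)
    then show ?thesis
      using 1 by (simp add: step goal rule_all)
  next
    case 2
    then have "Y (x, y)" "\<not> Y (x, y + 1)" "\<not> Y (x, y - 1)"
      using 2 xy on[of x y] off[of x "y + 1"] off[of x "y - 1"] by auto
    then show ?thesis
      using 2 by (simp add: step goal rule_opposite)
  next
    case 3
    then have "Y (x, y)" "\<not> Y (x - 1, y)" "\<not> Y (x + 1, y)"
      using 3 xy on[of x y] off[of "x - 1" y] off[of "x + 1" y] by auto
    then show ?thesis
      using 3 by (simp add: step goal rule_opposite)
  next
    case 4
    then have "odd (x + y - 1)"
      using N by simp
    then have "Y (x, y - 1)" "Y (x - 1, y)" "\<not> Y (x, y + 1)" "\<not> Y (x + 1, y)"
      using 4 xy on[of x "y - 1"] on[of "x - 1" y] out[of x "y + 1"] out[of "x + 1" y]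
      by (auto simp: algebra_simps)
    then show ?thesis
      using 4 rule_adjacent[of _ False True] by (simp add: step goal)
  next
    case 5
    then have "odd (x - 1)"
      using N by simp
    then have "Y (x - 1, y)" "\<not> Y (x, y)" "\<not> Y (x, y - 1)" "\<not> Y (x, y + 1)" "\<not> Y (x + 1, y)"
      using 5 N on[of "x - 1" y] out[of x y] out[of x "y - 1"] out[of x "y + 1"] out[of "x + 1" y]
      by auto
    then show ?thesis
      unfolding step goal using 5 rule_single by simp
  next
    case 6
    then have "\<not> Y (x - 1, y)" "\<not> Y (x, y)" "\<not> Y (x, y - 1)" "\<not> Y (x, y + 1)" "\<not> Y (x + 1, y)"
      using xy out[of "x - 1" y] out[of x y] out[of x "y - 1"] out[of x "y + 1"] out[of "x + 1" y]
      by auto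
    then show ?thesis
      using 6 xy by (simp add: step goal rule_none)
  qed
qed

text \<open>At the end of its stage the ball is only the origin, and each copy is generation
  \<open>M - 1\<close>, which is checkered. Translation by the even \<open>M\<close> preserves
  parities.\<close>

lemma checkered_double:
  assumes M: "even M" "M > 0" and "checkered M"
    and st: "\<And>x y. orbit (M + (M - 1)) (x, y) = stage M (M - 1) x y"
  shows "checkered (2 * M)"
proof -
  define Y where "Y = orbit (M - 1)"
  have on: "Y (a, b)" if "\<bar>a\<bar> + \<bar>b\<bar> < int M" "odd (a + b)" for a b
    using assms(3) that by (auto simp: checkered_def Y_def)
  have off: "\<not> Y (a, b)" if "odd a" "odd b" for a b
    using assms(3) that orbit_outside[of "M - 1" a b] M
    by (cases "\<bar>a\<bar> + \<bar>b\<bar> < int M") (auto simp: checkered_def Y_def)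
  have "2 * M - 1 = M + (M - 1)" using M by simp
  then have X2: "orbit (2 * M - 1) (x, y) \<longleftrightarrow> \<bar>x\<bar> + \<bar>y\<bar> \<le> 0 \<or> Y (x - int M, y) \<or> Y (x + int M, y)
      \<or> Y (x, y - int M) \<or> Y (x, y + int M)" for x y
    using M st by (simp add: stage_def Y_def)
  have "orbit (2 * M - 1) (x, y)" if "\<bar>x\<bar> + \<bar>y\<bar> < 2 * int M" "odd (x + y)" for x y
  proof -
    \<comment> \<open>Off the two diagonals, the open balls of radius \<open>M\<close> about the
      four centres cover the open ball of radius \<open>2 * M\<close>; on the diagonals
      \<open>x + y\<close> is even.\<close>
    have "\<bar>x\<bar> \<noteq> \<bar>y\<bar>"
      using that(2) by (auto simp: abs_eq_iff)
    then have "\<bar>x - int M\<bar> + \<bar>y\<bar> < int M \<or> \<bar>x + int M\<bar> + \<bar>y\<bar> < int M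
        \<or> \<bar>x\<bar> + \<bar>y - int M\<bar> < int M \<or> \<bar>x\<bar> + \<bar>y + int M\<bar> < int M"
      using that(1) by linarith
    moreover have "odd (x - int M + y)" "odd (x + int M + y)" "odd (x + (y - int M))"
        "odd (x + (y + int M))"
      using that(2) M by simp_all
    ultimately show ?thesis
      unfolding X2 using on by blast
  qed
  moreover have "\<not> orbit (2 * M - 1) (x, y)" if "odd x" "odd y" for x y
  proof -
    have "\<not> \<bar>x\<bar> + \<bar>y\<bar> \<le> 0" using that by (cases "x = 0") auto
    moreover have "odd (x - int M)" "odd (x + int M)" "odd (y - int M)" "odd (y + int M)"
      using that M by simp_all
    ultimately show ?thesis
      unfolding X2 using off that by blast
  qed
  ultimately show ?thesis
    unfolding checkered_def by simp
qed

lemma orbit_stage_less: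
  assumes "\<And>x y. orbit M (x, y) = stage M 0 x y" "r < M"
  shows "orbit (M + r) (x, y) = stage M r x y"
  using assms(2)
proof (induction r arbitrary: x y)
  case (Suc r)
  then show ?case by (intro orbit_stage_Suc) auto
qed (use assms in simp)

lemma checkered_2: "checkered 2"
proof -
  have "orbit 1 (x, y) \<longleftrightarrow> \<bar>x\<bar> + \<bar>y\<bar> \<le> 1" for x y
    unfolding orbit_stage_1_0 stage_def by auto
  moreover have "\<bar>x\<bar> + \<bar>y\<bar> \<ge> 2" if "odd x" "odd y" for x y :: int
    using that by (cases "x = 0"; cases "y = 0") auto
  ultimately show ?thesis
    by (force simp: checkered_def)
qed

lemma orbit_stage:
  assumes "r < 2 ^ k"
  shows "orbit (2 ^ k + r) (x, y) = stage (2 ^ k) r x y"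
proof -
  \<comment> \<open>The induction also carries the checkerboard at the last generation of the stage,
    from which the next stage starts.\<close>
  have "(\<forall>r<2 ^ k. \<forall>x y. orbit (2 ^ k + r) (x, y) = stage (2 ^ k) r x y)
      \<and> checkered (2 ^ Suc k)"
  proof (induction k)
    case 0
    then show ?case
      using orbit_stage_1_0 checkered_2 by simp
  next
    case (Suc k)
    let ?N = "2 ^ Suc k :: nat"
    have N: "even ?N" "?N > 0" by simp_all
    have ch: "checkered ?N" using Suc by blast
    have st: "orbit (?N + r) (x, y) = stage ?N r x y" if "r < ?N" for r x y
      using orbit_stage_0[OF N ch] that by (rule orbit_stage_less)
    moreover have "checkered (2 * ?N)"
      using N ch by (rule checkered_double) (rule st, simp)
    ultimately show ?case by simp
  qed
  then show ?thesis
    using assms by blast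
qed

section \<open>Counting live sites\<close>

definition live :: "nat \<Rightarrow> nat" where
  "live n = card {p. orbit n p}"

lemma finite_live: "finite {p. orbit n p}"
  unfolding orbit_def using symmetrical rule_b by (intro finite_orbit) (auto simp: is_Tb_def)

lemma live_stage:
  assumes "r < 2 ^ k"
  shows "live (2 ^ k + r) = 4 * live r
    + card {(x :: int, y :: int). \<bar>x\<bar> + \<bar>y\<bar> \<le> int (2 ^ k - 1 - r)}"
proof -
  define M where "M = int (2 ^ k)"
  define R where "R = int (2 ^ k - 1 - r)"
  define D where "D = {(x, y). \<bar>x\<bar> + \<bar>y\<bar> \<le> R}"
  define C where "C = (\<lambda>(a, b). (\<lambda>(x, y). (x + a, y + b)) ` {p. orbit r p})"
  define cs where "cs = {(M, 0), (- M, 0), (0, M), (0, - M)}"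
  \<comment> \<open>Source of all disjointness: the centres are \<open>M > R + r\<close> away from
    the origin and \<open>2 * M > 2 * r\<close> from each other.\<close>
  have MR: "M = R + 1 + int r"
    using assms by (auto simp: M_def R_def)
  have R: "R \<ge> 0" by (simp add: R_def)
  have mem: "(x, y) \<in> C (a, b) \<longleftrightarrow> orbit r (x - a, y - b)" for x y a b
    by (force simp: C_def image_iff)
  have near: "\<bar>x - a\<bar> + \<bar>y - b\<bar> \<le> int r" if "(x, y) \<in> C (a, b)" for x y a b
    using that orbit_support by (auto simp: mem)
  have eq: "{p. orbit (2 ^ k + r) p} = D \<union> (\<Union>c\<in>cs. C c)"
  proof -
    have "\<bar>x\<bar> + \<bar>y\<bar> \<le> int (2 ^ k) - 1 - int r \<longleftrightarrow> \<bar>x\<bar> + \<bar>y\<bar> \<le> R" for x y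
      using MR by (simp add: M_def)
    then show ?thesis
      using orbit_stage[OF assms] by (auto simp: stage_def cs_def D_def mem M_def)
  qed
  have fin: "finite (C c)" for c
    by (cases c) (auto simp: C_def finite_live)
  have card: "card (C c) = live r" for c
    unfolding C_def live_def by (cases c) (auto intro!: card_image simp: inj_on_def)
  have "D \<subseteq> {- R..R} \<times> {- R..R}"
    by (auto simp: D_def)
  then have finD: "finite D"
    by (rule finite_subset) simp
  have disj: "C c \<inter> C c' = {}" if "c \<in> cs" "c' \<in> cs" "c \<noteq> c'" for c c'
  proof (rule ccontr)
    assume "C c \<inter> C c' \<noteq> {}"
    then obtain x y where "(x, y) \<in> C c" "(x, y) \<in> C c'" by auto
    with that R MR show False
      by (auto simp: cs_def dest!: near)
  qed
  have disjD: "D \<inter> (\<Union>c\<in>cs. C c) = {}"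
  proof (rule ccontr)
    assume "D \<inter> (\<Union>c\<in>cs. C c) \<noteq> {}"
    then obtain x y c where "(x, y) \<in> D" "c \<in> cs" "(x, y) \<in> C c" by auto
    with R MR show False
      by (auto simp: cs_def D_def dest!: near)
  qed
  have "card cs = 4"
    using MR R by (simp add: cs_def)
  moreover have "card (\<Union>c\<in>cs. C c) = (\<Sum>c\<in>cs. card (C c))"
    by (rule card_UN_disjoint) (use fin disj in \<open>auto simp: cs_def\<close>)
  ultimately show ?thesis
    unfolding live_def eq using card finD fin disjD
    by (subst card_Un_disjoint) (auto simp: cs_def D_def R_def live_def)
qed

end

text \<open>In the coordinates \<^term>\<open>x + y\<close> and \<^term>\<open>x - y\<close>, the points of the ball with the parity
  of the radius form a square grid of side \<^term>\<open>R + 1\<close>, and the others one of side \<^term>\<open>R\<close>.\<close>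

lemma card_l1_ball:
  "card {(x :: int, y :: int). \<bar>x\<bar> + \<bar>y\<bar> \<le> int R} = 2 * R * (R + 1) + 1"
proof -
  define g where "g e = (\<lambda>(a :: int, b). (a + b - e, a - b))" for e
  have inj: "inj_on (g e) S" for e S
    by (auto simp: g_def inj_on_def)
  let ?P = "g (int R) ` ({0..int R} \<times> {0..int R})"
  let ?Q = "g (int R - 1) ` ({0..<int R} \<times> {0..<int R})"
  have "(x, y) \<in> ?P \<union> ?Q \<longleftrightarrow> \<bar>x\<bar> + \<bar>y\<bar> \<le> int R" for x y
  proof
    assume le: "\<bar>x\<bar> + \<bar>y\<bar> \<le> int R"
    show "(x, y) \<in> ?P \<union> ?Q"
    proof (cases "even (x + y + int R)")
      case True
      then obtain a where a: "x + y + int R = 2 * a" by blast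
      then have "(x, y) = g (int R) (a, a - y)" "(a, a - y) \<in> {0..int R} \<times> {0..int R}"
        using le by (auto simp: g_def)
      then show ?thesis by blast
    next
      case False
      then obtain a where a: "x + y + int R = 2 * a + 1" by (elim oddE)
      then have "(x, y) = g (int R - 1) (a, a - y)" "(a, a - y) \<in> {0..<int R} \<times> {0..<int R}"
        using le by (auto simp: g_def)
      then show ?thesis by blast
    qed
  qed (auto simp: g_def)
  then have eq: "{(x :: int, y :: int). \<bar>x\<bar> + \<bar>y\<bar> \<le> int R} = ?P \<union> ?Q"
    by auto
  have "?P \<inter> ?Q = {}"
  proof -
    have "False" if "a + b - int R = a' + b' - (int R - 1)" "a - b = a' - b'" for a b a' b'
      using that by presburger
    then show ?thesis by (auto simp: g_def)
  qed
  moreover have "nat (int R + 1) = R + 1" by simp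
  ultimately have "card (?P \<union> ?Q) = (R + 1) * (R + 1) + R * R"
    by (subst card_Un_disjoint) (auto simp: card_image[OF inj] card_cartesian_product)
  then show ?thesis
    unfolding eq by simp
qed

text \<open>As \<open>num T t\<close> counts generation \<open>t - 1\<close>, this is the stage at
  \<open>r = s - 1\<close>. The shift lets \<open>s\<close> reach \<open>2 ^ k\<close>, so time
  \<open>2 ^ Suc k\<close> falls at the end of a stage.\<close>

lemma num_rec:
  assumes "is_Tb T" and s: "1 \<le> s" "s \<le> 2 ^ k"
  shows "num T (2 ^ k + s) = 4 * num T s + (2 * (2 ^ k - s) * (2 ^ k - s + 1) + 1)"
proof -
  obtain f where f: "T = eca f" "symmetrical f" "rule_b f"
    using assms(1) by (auto simp: is_Tb_def)
  interpret b_rule f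
    by standard fact+
  have num: "num T n = live (n - 1)" if "n \<ge> 1" for n
    using that unfolding num_def live_def orbit_def f(1) Sum_any.expand_set by simp
  have "num T (2 ^ k + s) = live (2 ^ k + (s - 1))"
    using s by (simp add: num)
  also have "\<dots> = 4 * live (s - 1) + (2 * (2 ^ k - s) * (2 ^ k - s + 1) + 1)"
  proof -
    have "s - 1 < 2 ^ k" "2 ^ k - 1 - (s - 1) = 2 ^ k - s"
      using s by simp_all
    then show ?thesis
      by (simp only: live_stage card_l1_ball)
  qed
  finally show ?thesis
    using s by (simp add: num)
qed

lemma num_1: "num T (Suc 0) = 1"
  unfolding num_def seed_def Sum_any.expand_set by simp

lemma num_power_2:
  assumes "is_Tb T"
  shows "real (num T (2 ^ k)) = (4 * 4 ^ k - 1) / 3"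
proof (induction k)
  case 0
  then show ?case by (simp add: num_1)
next
  case (Suc k)
  have "num T (2 ^ Suc k) = 4 * num T (2 ^ k) + 1"
    using num_rec[OF assms, of "2 ^ k" k] by (simp add: mult_2)
  then show ?case using Suc by (simp add: field_simps)
qed

section \<open>The function \<open>A\<close> and the expansion in binary digits\<close>

lemma floor_log_power_add:
  assumes "s < 2 ^ k"
  shows "floor_log (2 ^ k + s) = k"
proof -
  have "2 ^ floor_log (2 ^ k + s) < (2 :: nat) ^ Suc k"
    using floor_log_exp2_le[of "2 ^ k + s"] assms by simp
  moreover have "(2 :: nat) ^ k < 2 ^ Suc (floor_log (2 ^ k + s))"
    using floor_log_exp2_gt[of "2 ^ k + s"] by simp
  ultimately have "floor_log (2 ^ k + s) < Suc k" "k < Suc (floor_log (2 ^ k + s))"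
    by (auto intro: power_less_imp_less_exp[of "2 :: nat"] simp del: power_Suc)
  then show ?thesis by simp
qed

lemma A_power_2: "A (2 ^ k) = (4 * 4 ^ k - 1) / 3"
proof -
  have "(\<Prod>j<k. 1 - of_bool (bit (2 ^ k :: nat) j)) = (1 :: real)"
    by (intro prod.neutral) (auto simp: bit_exp_iff)
  moreover have "(4 :: real) ^ k = 2 ^ k * 2 ^ k"
    by (simp flip: power_mult_distrib)
  ultimately show ?thesis
    by (simp add: A_def Let_def field_simps)
qed

text \<open>Some digit below position \<open>k\<close> is 1, otherwise \<open>s\<close> would be 0;
  it kills the product and leaves the size of the ball of radius \<open>2 ^ k - s\<close>.\<close>

lemma A_rec:
  assumes "0 < s" "s < 2 ^ k"
  shows "A (2 ^ k + s) = real (2 * (2 ^ k - s) * (2 ^ k - s + 1) + 1)"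
proof -
  have "\<exists>j<k. bit (2 ^ k + s) j"
  proof (rule ccontr)
    assume "\<not> ?thesis"
    then have "take_bit k (2 ^ k + s) = 0"
      by (auto intro!: bit_eqI simp: bit_take_bit_iff)
    then show False
      using assms by (simp add: take_bit_eq_mod)
  qed
  then have prod: "(\<Prod>j<k. 1 - of_bool (bit (2 ^ k + s) j)) = (0 :: real)"
    by (intro prod_zero) auto
  define R where "R = 2 ^ k - s"
  have R: "2 ^ (k + 1) - real (2 ^ k + s) = real R"
    using assms by (simp add: R_def)
  show ?thesis
    unfolding A_def Let_def floor_log_power_add[OF assms(2)] prod R R_def[symmetric]
    by (simp add: algebra_simps)
qed

text \<open>The product term of \<open>A\<close> brings \<open>s = 0\<close> into the same
  recursion: since \<open>num T 0 = 0\<close>, the value \<open>A (2 ^ k)\<close> has to be the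
  whole count.\<close>

lemma num_rec_A:
  assumes "is_Tb T" "s < 2 ^ k"
  shows "real (num T (2 ^ k + s)) = 4 * real (num T s) + A (2 ^ k + s)"
proof (cases "s = 0")
  case True
  then show ?thesis
    by (simp add: num_def[of T 0] num_power_2[OF assms(1)] A_power_2)
next
  case False
  then show ?thesis
    using num_rec[OF assms(1), of s k] A_rec[of s k] assms(2) by simp
qed

lemma digits_less:
  fixes d :: "nat \<Rightarrow> nat"
  assumes "\<And>i. d i \<in> {0, 1}"
  shows "(\<Sum>j<k. d j * 2 ^ j) < 2 ^ k"
proof (induction k)
  case (Suc k)
  then show ?case using assms[of k] by auto
qed simp

text \<open>Induction on the number of digits, with leading zeros allowed. A new leading 1
  multiplies the old count by 4 and adds one value of \<open>A\<close>; a leading 0 changes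
  nothing.\<close>

lemma num_digits:
  fixes d :: "nat \<Rightarrow> nat"
  assumes "is_Tb T" and d: "\<And>i. d i \<in> {0, 1}"
  shows "real (num T (\<Sum>j<k. d j * 2 ^ j)) =
    (\<Sum>p<k. real (d p) * 4 ^ (\<Sum>q=Suc p..<k. d q) * A (\<Sum>j\<le>p. d j * 2 ^ j))"
proof (induction k)
  case 0
  then show ?case by (simp add: num_def)
next
  case (Suc k)
  let ?s = "\<Sum>j<k. d j * 2 ^ j"
  have "(\<Sum>p<k. real (d p) * 4 ^ (\<Sum>q=Suc p..<Suc k. d q) * A (\<Sum>j\<le>p. d j * 2 ^ j)) =
      4 ^ d k * (\<Sum>p<k. real (d p) * 4 ^ (\<Sum>q=Suc p..<k. d q) * A (\<Sum>j\<le>p. d j * 2 ^ j))"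
    unfolding sum_distrib_left by (intro sum.cong) (auto simp: power_add)
  moreover have "(\<Sum>j\<le>k. d j * 2 ^ j) = ?s + d k * 2 ^ k"
    by (simp flip: lessThan_Suc_atMost)
  moreover have "d k = 0 \<or> d k = 1"
    using d[of k] by auto
  ultimately show ?case
    using num_rec_A[OF assms(1) digits_less[of d k, OF d]] Suc.IH by (auto simp: add.commute)
qed

section \<open>Cumulative counts at powers of two\<close>

text \<open>These sums of taxicab ball sizes are the octahedral numbers.\<close>

lemma sum_l1_balls: "(\<Sum>R<M. 2 * real R * (real R + 1) + 1) = real M * (2 * real M ^ 2 + 1) / 3"
  by (induction M) (simp_all add: field_simps power2_eq_square)

text \<open>With \<open>M = 2 ^ k\<close>, summing \<open>num_rec\<close> over the upper half of the
  times multiplies the old total by 4 + 1 = 5 and adds \<open>M * (2 * M ^ 2 + 1) / 3\<close>, which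
  produces the \<open>8 ^ k\<close> and \<open>2 ^ k\<close> terms.\<close>

lemma cum_power_2:
  assumes "is_Tb T"
  shows "real (cum T (2 ^ k)) = 8 * 5 ^ k / 9 + 2 / 9 * 8 ^ k - 1 / 9 * 2 ^ k"
proof (induction k)
  case 0
  then show ?case by (simp add: cum_def num_1)
next
  case (Suc k)
  let ?M = "2 ^ k :: nat"
  have "cum T (2 ^ Suc k) = cum T ?M + (\<Sum>n=?M+1..?M+?M. num T n)"
    unfolding cum_def by (subst sum.ub_add_nat[symmetric]) (simp_all add: mult_2)
  also have "(\<Sum>n=?M+1..?M+?M. num T n) = (\<Sum>s=1..?M. num T (?M + s))"
    by (rule sum.reindex_bij_witness[of _ "\<lambda>s. ?M + s" "\<lambda>n. n - ?M"]) auto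
  also have "\<dots> = (\<Sum>s=1..?M. 4 * num T s + (2 * (?M - s) * (?M - s + 1) + 1))"
    by (intro sum.cong refl num_rec[OF assms]) auto
  also have "\<dots> = 4 * cum T ?M + (\<Sum>s=1..?M. 2 * (?M - s) * (?M - s + 1) + 1)"
    unfolding cum_def sum.distrib sum_distrib_left ..
  also have "(\<Sum>s=1..?M. 2 * (?M - s) * (?M - s + 1) + 1) = (\<Sum>R<?M. 2 * R * (R + 1) + 1)"
    by (rule sum.reindex_bij_witness[of _ "\<lambda>R. ?M - R" "\<lambda>s. ?M - s"]) auto
  finally have "real (cum T (2 ^ Suc k)) =
      5 * real (cum T ?M) + (\<Sum>R<?M. 2 * real R * (real R + 1) + 1)"
    by (simp add: algebra_simps)
  moreover have "(8 :: real) ^ k = 2 ^ k * (2 ^ k) ^ 2"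
    by (simp add: power2_eq_square flip: power_mult_distrib)
  ultimately show ?case
    unfolding sum_l1_balls using Suc by (simp add: field_simps)
qed

theorem proposition4:
  fixes T :: "config \<Rightarrow> config"
  assumes "is_Tb T"
  shows "(\<forall>(k::nat) (d::nat \<Rightarrow> nat) (t::nat).
            (\<forall>i. d i \<in> {0, 1}) \<and> d k = 1 \<and> (\<forall>i>k. d i = 0) \<and> t = (\<Sum>i=0..k. d i * 2 ^ i) \<longrightarrow>
            real (num T t) =
              (\<Sum>i=0..k. real (d (k - i)) * 4 ^ (\<Sum>j=0..i. d (k - j + 1))
                 * A (\<Sum>j=0..k - i. d j * 2 ^ j)))
       \<and> (\<forall>k::nat. real (cum T (2 ^ k)) = 8 * 5 ^ k / 9 + 2 / 9 * 8 ^ k - 1 / 9 * 2 ^ k)"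
proof (intro conjI allI impI)
  fix k :: nat and d :: "nat \<Rightarrow> nat" and t :: nat
  assume a: "(\<forall>i. d i \<in> {0, 1}) \<and> d k = 1 \<and> (\<forall>i>k. d i = 0) \<and> t = (\<Sum>i=0..k. d i * 2 ^ i)"
  then have d_top: "d (Suc k) = 0" by simp
  \<comment> \<open>The stated exponent runs over positions \<open>k + 1\<close> down to
    \<open>k - i + 1\<close>. Position \<open>k + 1\<close> contributes 0 by \<open>d_top\<close>,
    so the sum counts the nonzero digits strictly above position \<open>k - i\<close>.\<close>
  have exponent: "(\<Sum>j=0..i. d (k - j + 1)) = (\<Sum>q=Suc (k - i)..<Suc k. d q)" if "i \<le> k" for i
  proof -
    have "(\<Sum>j=0..i. d (k - j + 1)) = (\<Sum>q=Suc (k - i)..Suc k. d q)"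
      by (rule sum.reindex_bij_witness[of _ "\<lambda>q. Suc k - q" "\<lambda>j. k - j + 1"]) (use that in auto)
    also have "{Suc (k - i)..Suc k} = insert (Suc k) {Suc (k - i)..<Suc k}"
      by auto
    finally show ?thesis
      by (simp add: d_top del: sum.op_ivl_Suc)
  qed
  have "t = (\<Sum>j<Suc k. d j * 2 ^ j)"
    using a by (simp add: atLeast0AtMost lessThan_Suc_atMost)
  then have "real (num T t) = (\<Sum>p<Suc k. real (d p) * 4 ^ (\<Sum>q=Suc p..<Suc k. d q)
      * A (\<Sum>j\<le>p. d j * 2 ^ j))"
    using num_digits[OF assms, of d "Suc k"] a by simp
  also have "\<dots> = (\<Sum>i=0..k. real (d (k - i)) * 4 ^ (\<Sum>q=Suc (k - i)..<Suc k. d q)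
      * A (\<Sum>j=0..k - i. d j * 2 ^ j))"
    by (rule sum.reindex_bij_witness[of _ "\<lambda>i. k - i" "\<lambda>p. k - p"])
      (auto simp: atLeast0AtMost simp del: sum.op_ivl_Suc)
  also have "\<dots> = (\<Sum>i=0..k. real (d (k - i)) * 4 ^ (\<Sum>j=0..i. d (k - j + 1))
      * A (\<Sum>j=0..k - i. d j * 2 ^ j))"
    by (intro sum.cong refl) (subst exponent, simp_all)
  finally show "real (num T t) = (\<Sum>i=0..k. real (d (k - i)) * 4 ^ (\<Sum>j=0..i. d (k - j + 1))
      * A (\<Sum>j=0..k - i. d j * 2 ^ j))" .
qed (rule cum_power_2[OF assms])

end
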